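(* Suppose $n\ge 3$. Then there exist $\gamma\in(0,1)$ and two interaction networks $G=[g_{ij}]$ and $G'=[g'_{ij}]$ on $N=\{1,\dots,n\}$ with $G\le G'$ (that is, $g_{ij}\le g'_{ij}$ for all $i,j\in N$) such that, for all $\tau_x,\tau_y>0$ with $\tau_x/(\tau_x+\tau_y)=\gamma$, $$\Delta W(\tau_x,\tau_y,G')<0<\Delta W(\tau_x,\tau_y,G).$$
   Context: Interaction network: an $n\times n$ real matrix $G=[g_{ij}]$ with $g_{ij}\ge 0$, $g_{ii}=0$, and $d_i^{out}:=\sum_{j\ne i}g_{ij}<1$ for all $i\in N$. Payoffs: agent $i$ chooses $a_i\in\mathbb{R}$; with $a=(a_j)_{j\in N}$ and common state $\theta\in\mathbb{R}$, $$u_i(a,\theta)=-\Big(1-\sum_{j\neq i}g_{ij}\Big)(a_i-\theta)^2-\sum_{j\ne i}g_{ij}(a_i-a_j)^2 .$$ Information: $\theta$ has the improper uniform prior on $\mathbb{R}$. Agent $i$ observes a private signal $x_i=\theta+\varepsilon_i$ and a public signal $y=\theta+\varepsilon_y$, where $\varepsilon_i\sim N(0,\tau_x^{-1})$, $\varepsilon_y\sim N(0,\tau_y^{-1})$, and $\theta,\varepsilon_1,\dots,\varepsilon_n,\varepsilon_y$ are jointly independent. $\gamma=\tau_x/(\tau_x+\tau_y)\in(0,1)$. Katz-Bonacich centrality vector: $\mathbf{c}(\gamma,G)=(c_1(\gamma,G),\dots,c_n(\gamma,G))'=(I-\gamma G)^{-1}\mathbf{1}$, where $\mathbf{1}$ is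 the all-ones vector. Equilibrium: the game has a unique linear Bayesian Nash equilibrium, $a_i^*=(1-\gamma)c_i(\gamma,G)\,y+\big(1-(1-\gamma)c_i(\gamma,G)\big)x_i$ for $i\in N$. Aggregate welfare: $W(\tau_x,\tau_y,G)=\sum_{i\in N}\mathbb{E}[u_i(a^*,\theta)]$, where the expectation is over the noise terms (the payoffs $u_i(a^*,\theta)$ depend only on the noise terms, not on $\theta$). $W(\tau_x,0,G)=-\sum_{i\in N}\tau_x^{-1}(1+d_i^{out})$ denotes aggregate equilibrium welfare in the absence of the public signal (where $a_i=x_i$ for all $i$). The welfare effect of public information provision is $\Delta W(\tau_x,\tau_y,G)=W(\tau_x,\tau_y,G)-W(\tau_x,0,G)$. *)

theory Defs
  imports "HOL-Probability.Probability"
begin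

definition out_degree :: "real^'n^'n \<Rightarrow> 'n::finite \<Rightarrow> real" where
  "out_degree G i = (\<Sum>j\<in>UNIV - {i}. G $ i $ j)"

definition interaction_network :: "real^'n^'n::finite \<Rightarrow> bool" where
  "interaction_network G \<longleftrightarrow>
     (\<forall>i j. 0 \<le> G $ i $ j) \<and> (\<forall>i. G $ i $ i = 0) \<and> (\<forall>i. out_degree G i < 1)"

text \<open>In \<^typ>\<open>real^'n\<close> the constant \<open>1\<close> is the all-ones vector.\<close>

definition katz_bonacich :: "real \<Rightarrow> real^'n^'n \<Rightarrow> real^'n::finite" where
  "katz_bonacich \<gamma> G = matrix_inv (mat 1 - \<gamma> *\<^sub>R G) *v 1"

definition payoff :: "real^'n^'n \<Rightarrow> 'n::finite \<Rightarrow> ('n \<Rightarrow> real) \<Rightarrow> real \<Rightarrow> real" where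
  "payoff G i a \<theta> =
     - (1 - (\<Sum>j\<in>UNIV - {i}. G $ i $ j)) * (a i - \<theta>)\<^sup>2
     - (\<Sum>j\<in>UNIV - {i}. G $ i $ j * (a i - a j)\<^sup>2)"

definition gaussian_noise :: "real \<Rightarrow> real measure" where
  "gaussian_noise \<tau> = density lborel (\<lambda>e. ennreal (normal_density 0 (1 / sqrt \<tau>) e))"

definition private_noise :: "real \<Rightarrow> ('n::finite \<Rightarrow> real) measure" where
  "private_noise \<tau>x = Pi\<^sub>M UNIV (\<lambda>_. gaussian_noise \<tau>x)"

definition joint_noise :: "real \<Rightarrow> real \<Rightarrow> (('n::finite \<Rightarrow> real) \<times> real) measure" where
  "joint_noise \<tau>x \<tau>y = private_noise \<tau>x \<Otimes>\<^sub>M gaussian_noise \<tau>y"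

definition signal_density :: "real \<Rightarrow> real \<Rightarrow> real \<Rightarrow> real \<Rightarrow> real \<Rightarrow> real" where
  "signal_density \<tau>x \<tau>y x y \<theta> =
     normal_density \<theta> (1 / sqrt \<tau>x) x * normal_density \<theta> (1 / sqrt \<tau>y) y"

text \<open>Bayes' rule with the improper uniform prior: \<^const>\<open>lborel\<close> plays the role of the prior
  of the state.\<close>

definition posterior :: "real \<Rightarrow> real \<Rightarrow> real \<Rightarrow> real \<Rightarrow> real measure" where
  "posterior \<tau>x \<tau>y x y =
     density lborel (\<lambda>\<theta>. ennreal (signal_density \<tau>x \<tau>y x y \<theta> /
                                 (\<integral>t. signal_density \<tau>x \<tau>y x y t \<partial>lborel)))"

text \<open>\<open>s i x y\<close> is the action of agent \<open>i\<close> at private signal \<open>x\<close> and public signal \<open>y\<close>.\<close>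

type_synonym 'n profile = "'n \<Rightarrow> real \<Rightarrow> real \<Rightarrow> real"

text \<open>Expected payoff of agent \<open>i\<close> from action \<open>b\<close> given the signals \<open>x\<close>, \<open>y\<close>, when the
  other agents follow \<open>s\<close>.  Given agent \<open>i\<close>'s signals, the state has the posterior distribution and
  is independent of the noise terms of the other agents; the \<open>i\<close>-th coordinate of the noise
  vector does not occur in the integrand.\<close>

definition interim_payoff ::
    "real^'n^'n \<Rightarrow> real \<Rightarrow> real \<Rightarrow> 'n::finite profile \<Rightarrow> 'n \<Rightarrow> real \<Rightarrow> real \<Rightarrow> real \<Rightarrow> real" where
  "interim_payoff G \<tau>x \<tau>y s i x y b =
     (\<integral>(\<theta>, \<epsilon>). payoff G i (\<lambda>j. if j = i then b else s j (\<theta> + \<epsilon> j) y) \<theta>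
        \<partial>(posterior \<tau>x \<tau>y x y \<Otimes>\<^sub>M private_noise \<tau>x))"

text \<open>An intercept is allowed; in equilibrium it vanishes.\<close>

definition linear_strategy :: "(real \<Rightarrow> real \<Rightarrow> real) \<Rightarrow> bool" where
  "linear_strategy f \<longleftrightarrow> (\<exists>\<alpha> \<beta> \<kappa>. \<forall>x y. f x y = \<alpha> * x + \<beta> * y + \<kappa>)"

definition linear_BNE :: "real^'n^'n \<Rightarrow> real \<Rightarrow> real \<Rightarrow> 'n::finite profile \<Rightarrow> bool" where
  "linear_BNE G \<tau>x \<tau>y s \<longleftrightarrow>
     (\<forall>i. linear_strategy (s i)) \<and>
     (\<forall>i x y b. interim_payoff G \<tau>x \<tau>y s i x y b \<le> interim_payoff G \<tau>x \<tau>y s i x y (s i x y))"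

text \<open>The description is proper: see \<open>linear_BNE_iff\<close> and \<open>equilibrium_eq\<close> below.\<close>

definition equilibrium :: "real^'n^'n \<Rightarrow> real \<Rightarrow> real \<Rightarrow> 'n::finite profile" where
  "equilibrium G \<tau>x \<tau>y = (THE s. linear_BNE G \<tau>x \<tau>y s)"

text \<open>Welfare is the expectation over the noise terms at a given state \<open>\<theta>\<close>; its value
  does not depend on \<open>\<theta>\<close> (\<open>welfare_effect_state_independent\<close> below).\<close>

definition welfare :: "real \<Rightarrow> real \<Rightarrow> real^'n^'n::finite \<Rightarrow> real \<Rightarrow> real" where
  "welfare \<tau>x \<tau>y G \<theta> =
     (\<Sum>i\<in>UNIV. \<integral>(\<epsilon>, \<eta>). payoff G i (\<lambda>j. equilibrium G \<tau>x \<tau>y j (\<theta> + \<epsilon> j) (\<theta> + \<eta>)) \<theta>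
        \<partial>(joint_noise \<tau>x \<tau>y))"

text \<open>Without the public signal every agent plays the private signal.\<close>

definition welfare_no_public :: "real \<Rightarrow> real^'n^'n::finite \<Rightarrow> real \<Rightarrow> real" where
  "welfare_no_public \<tau>x G \<theta> =
     (\<Sum>i\<in>UNIV. \<integral>\<epsilon>. payoff G i (\<lambda>j. \<theta> + \<epsilon> j) \<theta> \<partial>(private_noise \<tau>x))"

definition welfare_effect :: "real \<Rightarrow> real \<Rightarrow> real^'n^'n::finite \<Rightarrow> real \<Rightarrow> real" where
  "welfare_effect \<tau>x \<tau>y G \<theta> = welfare \<tau>x \<tau>y G \<theta> - welfare_no_public \<tau>x G \<theta>"

lemma signal_density_eq:
  assumes [arith]: "0 < \<tau>x" "0 < \<tau>y"
  shows "signal_density \<tau>x \<tau>y x y \<theta> =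
    normal_density x (sqrt (1 / \<tau>x + 1 / \<tau>y)) y *
    normal_density ((\<tau>x * x + \<tau>y * y) / (\<tau>x + \<tau>y)) (1 / sqrt (\<tau>x + \<tau>y)) \<theta>"
proof -
  have s: "(1 / sqrt \<tau>x)\<^sup>2 = 1 / \<tau>x" "(1 / sqrt \<tau>y)\<^sup>2 = 1 / \<tau>y"
    "(1 / sqrt (\<tau>x + \<tau>y))\<^sup>2 = 1 / (\<tau>x + \<tau>y)"
    "(sqrt (1 / \<tau>x + 1 / \<tau>y))\<^sup>2 = 1 / \<tau>x + 1 / \<tau>y"
    using assms by (simp_all add: power_divide add_nonneg_nonneg del: real_sqrt_divide)
  have c: "sqrt (2 * pi * (1 / \<tau>x)) * sqrt (2 * pi * (1 / \<tau>y)) =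
    sqrt (2 * pi * (1 / \<tau>x + 1 / \<tau>y)) * sqrt (2 * pi * (1 / (\<tau>x + \<tau>y)))"
  proof -
    have "1 / \<tau>x + 1 / \<tau>y = (\<tau>x + \<tau>y) / (\<tau>x * \<tau>y)" by (simp add: field_simps)
    moreover have "2 * pi * (u / (\<tau>x * \<tau>y)) * (2 * pi * (1 / u)) = 2 * pi * (1 / \<tau>x) * (2 * pi * (1 / \<tau>y))"
      if "u \<noteq> 0" for u using that by simp
    ultimately show ?thesis
      unfolding real_sqrt_mult[symmetric] by simp
  qed
  define S where "S = \<tau>x + \<tau>y"
  define m where "m = (\<tau>x * x + \<tau>y * y) / S"
  have S[arith]: "0 < S" by (simp add: S_def)
  have mS: "m * S = \<tau>x * x + \<tau>y * y" by (simp add: m_def)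
  have k1: "- (x - \<theta>)\<^sup>2 / (2 * (1 / \<tau>x)) = - (\<tau>x * (x - \<theta>)\<^sup>2) / 2"
    "- (y - \<theta>)\<^sup>2 / (2 * (1 / \<tau>y)) = - (\<tau>y * (y - \<theta>)\<^sup>2) / 2"
    "- (\<theta> - m)\<^sup>2 / (2 * (1 / S)) = - (S * (\<theta> - m)\<^sup>2) / 2"
    by (simp_all)
  have "1 / \<tau>x + 1 / \<tau>y = S / (\<tau>x * \<tau>y)" by (simp add: S_def field_simps)
  then have k2: "- (y - x)\<^sup>2 / (2 * (1 / \<tau>x + 1 / \<tau>y)) = - (\<tau>x * \<tau>y * (y - x)\<^sup>2 / S) / 2"
    by (simp add: field_simps)
  have "S * (\<tau>x * (x - \<theta>)\<^sup>2 + \<tau>y * (y - \<theta>)\<^sup>2) = \<tau>x * \<tau>y * (y - x)\<^sup>2 + (S * \<theta> - m * S)\<^sup>2"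
    unfolding mS unfolding S_def by algebra
  also have "(S * \<theta> - m * S)\<^sup>2 = S * (S * (\<theta> - m)\<^sup>2)" by algebra
  finally have "\<tau>x * (x - \<theta>)\<^sup>2 + \<tau>y * (y - \<theta>)\<^sup>2 = \<tau>x * \<tau>y * (y - x)\<^sup>2 / S + S * (\<theta> - m)\<^sup>2"
    by (simp add: field_simps)
  then have e: "- (x - \<theta>)\<^sup>2 / (2 * (1 / \<tau>x)) + - (y - \<theta>)\<^sup>2 / (2 * (1 / \<tau>y)) =
    - (y - x)\<^sup>2 / (2 * (1 / \<tau>x + 1 / \<tau>y)) + - (\<theta> - m)\<^sup>2 / (2 * (1 / S))"
    unfolding k1 k2 by (simp add: field_simps)
  have p: "(1 / a * exp u) * (1 / b * exp v) = 1 / (a * b) * exp (u + v)" for a b u v :: real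
    by (simp add: exp_add)
  show ?thesis
    unfolding signal_density_def normal_density_def s p c
    using e unfolding S_def m_def by simp
qed

lemma posterior_eq:
  assumes "0 < \<tau>x" "0 < \<tau>y"
  shows "posterior \<tau>x \<tau>y x y =
    density lborel (normal_density ((\<tau>x * x + \<tau>y * y) / (\<tau>x + \<tau>y)) (1 / sqrt (\<tau>x + \<tau>y)))"
proof -
  have "normal_density x (sqrt (1 / \<tau>x + 1 / \<tau>y)) y \<noteq> 0"
    using normal_density_pos[of "sqrt (1 / \<tau>x + 1 / \<tau>y)" x y] assms by (simp add: add_pos_pos)
  then show ?thesis
    using assms by (simp add: posterior_def signal_density_eq add_pos_pos)
qed

lemma normal_measure_moments:
  fixes \<mu> \<sigma> :: real
  assumes "0 < \<sigma>"
  defines "M \<equiv> density lborel (\<lambda>e. ennreal (normal_density \<mu> \<sigma> e))"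
  shows "prob_space M" "sets M = sets borel"
    "integrable M (\<lambda>e. e)" "integral\<^sup>L M (\<lambda>e. e) = \<mu>"
    "integrable M (\<lambda>e. e\<^sup>2)" "integral\<^sup>L M (\<lambda>e. e\<^sup>2) = \<mu>\<^sup>2 + \<sigma>\<^sup>2"
proof -
  note [simp] = integrable_normal_moment_nz_1[OF assms(1)] integral_normal_moment_nz_1[OF assms(1)]
    integral_normal_density[OF assms(1)] integrable_normal_density[OF assms(1)]
  have q: "normal_density \<mu> \<sigma> e * e\<^sup>2 = normal_density \<mu> \<sigma> e * (e - \<mu>)\<^sup>2
    + (2 * \<mu>) * (normal_density \<mu> \<sigma> e * e) - \<mu>\<^sup>2 * normal_density \<mu> \<sigma> e" for e
    by algebra
  have v: "integrable lborel (\<lambda>e. normal_density \<mu> \<sigma> e * (e - \<mu>)\<^sup>2)"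
    by (rule integrable_normal_moment[OF assms(1)])
  have vi: "(\<integral>e. normal_density \<mu> \<sigma> e * (e - \<mu>)\<^sup>2 \<partial>lborel) = \<sigma>\<^sup>2"
    using integral_normal_moment_even[OF assms(1), of \<mu> 1] by (simp add: fact_numeral)
  show "prob_space M" unfolding M_def by (rule prob_space_normal_density[OF assms(1)])
  show "sets M = sets borel" by (simp add: M_def)
  show "integrable M (\<lambda>e. e)" "integral\<^sup>L M (\<lambda>e. e) = \<mu>"
    by (simp_all add: M_def integrable_density integral_density)
  show "integrable M (\<lambda>e. e\<^sup>2)" "integral\<^sup>L M (\<lambda>e. e\<^sup>2) = \<mu>\<^sup>2 + \<sigma>\<^sup>2"
    by (simp_all add: M_def integrable_density integral_density q v vi)
       (simp add: power2_eq_square)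
qed

lemma gaussian_noise_moments:
  assumes "0 < \<tau>"
  shows "prob_space (gaussian_noise \<tau>)" "sets (gaussian_noise \<tau>) = sets borel"
    "integrable (gaussian_noise \<tau>) (\<lambda>e. e)" "integral\<^sup>L (gaussian_noise \<tau>) (\<lambda>e. e) = 0"
    "integrable (gaussian_noise \<tau>) (\<lambda>e. e\<^sup>2)" "integral\<^sup>L (gaussian_noise \<tau>) (\<lambda>e. e\<^sup>2) = 1 / \<tau>"
  using normal_measure_moments[of "1 / sqrt \<tau>" 0] assms
  by (simp_all add: gaussian_noise_def power_divide)

lemma private_noise_prob_space:
  assumes "0 < \<tau>"
  shows "prob_space (private_noise \<tau>)"
  unfolding private_noise_def by (intro prob_space_PiM gaussian_noise_moments assms)

lemma private_noise_distr:
  assumes "0 < \<tau>"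
  shows "distr (private_noise \<tau>) (gaussian_noise \<tau>) (\<lambda>\<epsilon>. \<epsilon> i) = gaussian_noise \<tau>"
  unfolding private_noise_def
  by (rule distr_PiM_component) (simp_all add: gaussian_noise_moments assms)

lemma private_noise_measurable [measurable]:
  "(\<lambda>\<epsilon>. \<epsilon> i) \<in> private_noise \<tau> \<rightarrow>\<^sub>M borel"
proof -
  have "(\<lambda>\<epsilon>. \<epsilon> i) \<in> private_noise \<tau> \<rightarrow>\<^sub>M gaussian_noise \<tau>"
    unfolding private_noise_def by measurable
  also have "measurable (private_noise \<tau>) (gaussian_noise \<tau>) = measurable (private_noise \<tau>) borel"
    by (rule measurable_cong_sets) (simp_all add: gaussian_noise_def)
  finally show ?thesis .
qed

lemma private_noise_component:
  fixes f :: "real \<Rightarrow> real"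
  assumes \<tau>: "0 < \<tau>" and f[measurable]: "f \<in> borel_measurable borel"
  shows "integrable (private_noise \<tau>) (\<lambda>\<epsilon>. f (\<epsilon> i)) \<longleftrightarrow> integrable (gaussian_noise \<tau>) f"
    "(\<integral>\<epsilon>. f (\<epsilon> i) \<partial>private_noise \<tau>) = integral\<^sup>L (gaussian_noise \<tau>) f"
proof -
  have m: "(\<lambda>\<epsilon>. \<epsilon> i) \<in> private_noise \<tau> \<rightarrow>\<^sub>M gaussian_noise \<tau>"
    unfolding private_noise_def by measurable
  have f': "f \<in> borel_measurable (gaussian_noise \<tau>)"
    by (simp add: gaussian_noise_def)
  show "integrable (private_noise \<tau>) (\<lambda>\<epsilon>. f (\<epsilon> i)) \<longleftrightarrow> integrable (gaussian_noise \<tau>) f"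
    using integrable_distr_eq[OF m f'] unfolding private_noise_distr[OF \<tau>] by simp
  show "(\<integral>\<epsilon>. f (\<epsilon> i) \<partial>private_noise \<tau>) = integral\<^sup>L (gaussian_noise \<tau>) f"
    using integral_distr[OF m f'] unfolding private_noise_distr[OF \<tau>] by simp
qed

lemma private_noise_uncorrelated:
  assumes \<tau>: "0 < \<tau>" and ij: "i \<noteq> j"
  shows "(\<integral>\<epsilon>. \<epsilon> i * \<epsilon> j \<partial>private_noise \<tau>) = 0"
    "integrable (private_noise \<tau>) (\<lambda>\<epsilon>. \<epsilon> i * \<epsilon> j)"
proof -
  interpret P: prob_space "private_noise \<tau>" by (rule private_noise_prob_space[OF \<tau>])
  have ps: "prob_space (gaussian_noise \<tau>)" by (rule gaussian_noise_moments[OF \<tau>])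
  interpret G: prob_space "gaussian_noise \<tau>" by (rule ps)
  interpret F: product_sigma_finite "\<lambda>_::'a. gaussian_noise \<tau>"
    by standard
  define f :: "'a \<Rightarrow> real \<Rightarrow> real" where "f k e = (if k = i \<or> k = j then e else 1)" for k e
  have fi: "integrable (gaussian_noise \<tau>) (f k)" for k
    by (cases "k = i \<or> k = j") (auto simp: f_def [abs_def] gaussian_noise_moments[OF \<tau>])
  have pr: "(\<Prod>k\<in>UNIV. f k (\<epsilon> k)) = \<epsilon> i * \<epsilon> j" for \<epsilon>
  proof -
    have "(\<Prod>k\<in>UNIV. f k (\<epsilon> k)) = (\<Prod>k\<in>{i, j}. f k (\<epsilon> k))"
      by (rule prod.mono_neutral_right) (auto simp: f_def)
    also have "\<dots> = \<epsilon> i * \<epsilon> j" using ij by (simp add: f_def)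
    finally show ?thesis .
  qed
  have "integral\<^sup>L (gaussian_noise \<tau>) (f i) = 0"
    by (simp add: f_def [abs_def] gaussian_noise_moments[OF \<tau>])
  then have "(\<Prod>k\<in>UNIV. integral\<^sup>L (gaussian_noise \<tau>) (f k)) = 0"
    by (auto intro!: prod_zero)
  then show "(\<integral>\<epsilon>. \<epsilon> i * \<epsilon> j \<partial>private_noise \<tau>) = 0"
    using F.product_integral_prod[of UNIV f] fi by (simp add: pr private_noise_def)
  show "integrable (private_noise \<tau>) (\<lambda>\<epsilon>. \<epsilon> i * \<epsilon> j)"
    using F.product_integrable_prod[of UNIV f] fi by (simp add: pr private_noise_def)
qed

lemma welfare_no_public_eq:
  assumes \<tau>: "0 < \<tau>x"
  shows "welfare_no_public \<tau>x G \<theta> = - (\<Sum>i\<in>UNIV. (1 / \<tau>x) * (1 + out_degree G i))"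
proof -
  have m1: "integrable (private_noise \<tau>x) (\<lambda>\<epsilon>. (\<epsilon> i)\<^sup>2)"
    "(\<integral>\<epsilon>. (\<epsilon> i)\<^sup>2 \<partial>private_noise \<tau>x) = 1 / \<tau>x" for i :: 'a
    using private_noise_component[OF \<tau>, of "\<lambda>e. e\<^sup>2" i] by (simp_all add: gaussian_noise_moments[OF \<tau>])
  have d: "integrable (private_noise \<tau>x) (\<lambda>\<epsilon>. (\<epsilon> i - \<epsilon> j)\<^sup>2)"
    "(\<integral>\<epsilon>. (\<epsilon> i - \<epsilon> j)\<^sup>2 \<partial>private_noise \<tau>x) = 2 / \<tau>x" if "i \<noteq> j" for i j :: 'a
  proof -
    have e: "(\<epsilon> i - \<epsilon> j)\<^sup>2 = (\<epsilon> i)\<^sup>2 + (\<epsilon> j)\<^sup>2 - 2 * (\<epsilon> i * \<epsilon> j)" for \<epsilon> :: "'a \<Rightarrow> real"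
      by algebra
    show "integrable (private_noise \<tau>x) (\<lambda>\<epsilon>. (\<epsilon> i - \<epsilon> j)\<^sup>2)"
      "(\<integral>\<epsilon>. (\<epsilon> i - \<epsilon> j)\<^sup>2 \<partial>private_noise \<tau>x) = 2 / \<tau>x"
      by (simp_all add: e m1 private_noise_uncorrelated[OF \<tau> that])
  qed
  have "(\<integral>\<epsilon>. payoff G i (\<lambda>j. \<theta> + \<epsilon> j) \<theta> \<partial>private_noise \<tau>x) = - ((1 / \<tau>x) * (1 + out_degree G i))" for i
  proof -
    have "(\<integral>\<epsilon>. payoff G i (\<lambda>j. \<theta> + \<epsilon> j) \<theta> \<partial>private_noise \<tau>x) =
      (\<integral>\<epsilon>. - (1 - out_degree G i) * (\<epsilon> i)\<^sup>2 - (\<Sum>j\<in>UNIV - {i}. G $ i $ j * (\<epsilon> i - \<epsilon> j)\<^sup>2) \<partial>private_noise \<tau>x)"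
      by (simp add: payoff_def out_degree_def)
    also have "\<dots> = - (1 - out_degree G i) * (1 / \<tau>x) - (\<Sum>j\<in>UNIV - {i}. G $ i $ j * (2 / \<tau>x))"
      by (subst Bochner_Integration.integral_diff)
         (auto simp: m1 d Bochner_Integration.integral_sum intro!: Bochner_Integration.integrable_sum)
    also have "(\<Sum>j\<in>UNIV - {i}. G $ i $ j * (2 / \<tau>x)) = out_degree G i * (2 / \<tau>x)"
      by (simp only: out_degree_def sum_distrib_right)
    moreover have "- (1 - d) * (1 / t) - d * (2 / t) = - ((1 / t) * (1 + d))" for d t :: real
      by (simp add: algebra_simps add_divide_distrib diff_divide_distrib)
    ultimately show ?thesis by simp
  qed
  then show ?thesis by (simp add: welfare_no_public_def sum_negf)
qed

lemma network_fixed_point_zero: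
  fixes v :: "'n::finite \<Rightarrow> real"
  assumes G: "interaction_network G" and t: "0 \<le> t" "t \<le> 1"
    and v: "\<And>i. v i = t * (\<Sum>j\<in>UNIV - {i}. G $ i $ j * v j)"
  shows "v i = 0"
proof -
  define B where "B = Max (range (\<lambda>i. \<bar>v i\<bar>))"
  have le: "\<bar>v j\<bar> \<le> B" for j unfolding B_def by (rule Max_ge) auto
  have "B \<in> range (\<lambda>i. \<bar>v i\<bar>)" unfolding B_def by (rule Max_in) auto
  then obtain k where k: "B = \<bar>v k\<bar>" by auto
  have g: "0 \<le> G $ k $ j" for j using G by (simp add: interaction_network_def)
  have d: "out_degree G k < 1" using G by (simp add: interaction_network_def)
  have B0: "0 \<le> B" using k by simp
  have "B = t * \<bar>\<Sum>j\<in>UNIV - {k}. G $ k $ j * v j\<bar>"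
    using v[of k] k t by (metis abs_mult abs_of_nonneg)
  also have "\<dots> \<le> \<bar>\<Sum>j\<in>UNIV - {k}. G $ k $ j * v j\<bar>"
    using t by (simp add: mult_left_le_one_le)
  also have "\<dots> \<le> (\<Sum>j\<in>UNIV - {k}. G $ k $ j * B)"
    by (rule order_trans[OF sum_abs], rule sum_mono) (simp add: abs_mult g le mult_left_mono)
  also have "\<dots> = out_degree G k * B" by (simp add: out_degree_def sum_distrib_right)
  finally have "(1 - out_degree G k) * B \<le> 0" by (simp add: algebra_simps)
  then have "B \<le> 0" using d by (simp add: mult_le_0_iff)
  with le[of i] show ?thesis by simp
qed

lemma katz_matrix_component:
  assumes "interaction_network G"
  shows "((mat 1 - \<gamma> *\<^sub>R G) *v v) $ i = v $ i - \<gamma> * (\<Sum>j\<in>UNIV - {i}. G $ i $ j * v $ j)"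
proof -
  have z: "G $ i $ i = 0" using assms by (simp add: interaction_network_def)
  have "((\<gamma> *\<^sub>R G) *v v) $ i = \<gamma> * (\<Sum>j\<in>UNIV. G $ i $ j * v $ j)"
    by (simp add: matrix_vector_mult_def sum_distrib_left mult.assoc)
  also have "(\<Sum>j\<in>UNIV. G $ i $ j * v $ j) = (\<Sum>j\<in>UNIV - {i}. G $ i $ j * v $ j)"
    by (rule sum.mono_neutral_right) (auto simp: z)
  finally show ?thesis by (simp add: matrix_vector_mult_diff_rdistrib)
qed

lemma katz_bonacich_iff:
  assumes G: "interaction_network G" and \<gamma>: "0 \<le> \<gamma>" "\<gamma> \<le> 1"
  shows "v = katz_bonacich \<gamma> G \<longleftrightarrow>
    (\<forall>i. v $ i = 1 + \<gamma> * (\<Sum>j\<in>UNIV - {i}. G $ i $ j * v $ j))"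
proof -
  let ?A = "mat 1 - \<gamma> *\<^sub>R G"
  have "w = 0" if "?A *v w = 0" for w
  proof -
    have "w $ i = \<gamma> * (\<Sum>j\<in>UNIV - {i}. G $ i $ j * w $ j)" for i
      using that katz_matrix_component[OF G, of \<gamma> w i] by simp
    from network_fixed_point_zero[OF G \<gamma>, of "\<lambda>i. w $ i", OF this] show ?thesis
      by (simp add: vec_eq_iff)
  qed
  then have "invertible ?A"
    by (simp add: invertible_left_inverse matrix_left_invertible_ker)
  then have "?A ** matrix_inv ?A = mat 1 \<and> matrix_inv ?A ** ?A = mat 1"
    unfolding matrix_inv_def invertible_def by (rule someI_ex)
  then have "v = katz_bonacich \<gamma> G \<longleftrightarrow> ?A *v v = 1"
    unfolding katz_bonacich_def by (metis matrix_vector_mul_assoc matrix_vector_mul_lid)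
  also have "\<dots> \<longleftrightarrow> (\<forall>i. v $ i = 1 + \<gamma> * (\<Sum>j\<in>UNIV - {i}. G $ i $ j * v $ j))"
    unfolding vec_eq_iff katz_matrix_component[OF G] by (auto simp: diff_eq_eq)
  finally show ?thesis .
qed

lemma pair_prob_fst_snd:
  fixes f :: "'a \<Rightarrow> real" and g :: "'b \<Rightarrow> real"
  assumes P: "prob_space P" and Q: "prob_space Q"
  shows "integrable P f \<Longrightarrow> integrable (P \<Otimes>\<^sub>M Q) (\<lambda>z. f (fst z))"
    "integrable P f \<Longrightarrow> (\<integral>z. f (fst z) \<partial>(P \<Otimes>\<^sub>M Q)) = integral\<^sup>L P f"
    "integrable Q g \<Longrightarrow> integrable (P \<Otimes>\<^sub>M Q) (\<lambda>z. g (snd z))"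
    "integrable Q g \<Longrightarrow> (\<integral>z. g (snd z) \<partial>(P \<Otimes>\<^sub>M Q)) = integral\<^sup>L Q g"
proof -
  interpret P: prob_space P by fact
  interpret Q: prob_space Q by fact
  interpret PQ: pair_prob_space P Q ..
  have 1: "distr (P \<Otimes>\<^sub>M Q) P fst = P" by (rule Q.distr_pair_fst)
  have 2: "distr (P \<Otimes>\<^sub>M Q) Q snd = Q"
  proof (rule measure_eqI)
    fix A assume "A \<in> sets (distr (P \<Otimes>\<^sub>M Q) Q snd)"
    then have A: "A \<in> sets Q" by simp
    then have "snd -` A \<inter> space (P \<Otimes>\<^sub>M Q) = space P \<times> A"
      using sets.sets_into_space[OF A] by (auto simp: space_pair_measure)
    with A show "emeasure (distr (P \<Otimes>\<^sub>M Q) Q snd) A = emeasure Q A"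
      by (simp add: emeasure_distr Q.emeasure_pair_measure_Times P.emeasure_space_1)
  qed simp
  show "integrable P f \<Longrightarrow> integrable (P \<Otimes>\<^sub>M Q) (\<lambda>z. f (fst z))"
    using integrable_distr_eq[of fst "P \<Otimes>\<^sub>M Q" P f] 1 by auto
  show "integrable P f \<Longrightarrow> (\<integral>z. f (fst z) \<partial>(P \<Otimes>\<^sub>M Q)) = integral\<^sup>L P f"
    using integral_distr[of fst "P \<Otimes>\<^sub>M Q" P f] 1 by auto
  show "integrable Q g \<Longrightarrow> integrable (P \<Otimes>\<^sub>M Q) (\<lambda>z. g (snd z))"
    using integrable_distr_eq[of snd "P \<Otimes>\<^sub>M Q" Q g] 2 by auto
  show "integrable Q g \<Longrightarrow> (\<integral>z. g (snd z) \<partial>(P \<Otimes>\<^sub>M Q)) = integral\<^sup>L Q g"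
    using integral_distr[of snd "P \<Otimes>\<^sub>M Q" Q g] 2 by auto
qed

lemma integrable_square_sum:
  fixes f g :: "'a \<Rightarrow> real"
  assumes [measurable]: "f \<in> borel_measurable M" "g \<in> borel_measurable M"
    and fg: "integrable M (\<lambda>z. (f z)\<^sup>2)" "integrable M (\<lambda>z. (g z)\<^sup>2)"
  shows "integrable M (\<lambda>z. (f z + g z)\<^sup>2)"
proof (rule Bochner_Integration.integrable_bound[where f = "\<lambda>z. 2 * (f z)\<^sup>2 + 2 * (g z)\<^sup>2"])
  show "AE z in M. norm ((f z + g z)\<^sup>2) \<le> norm (2 * (f z)\<^sup>2 + 2 * (g z)\<^sup>2)"
  proof (rule AE_I2)
    fix z
    have "2 * (f z)\<^sup>2 + 2 * (g z)\<^sup>2 - (f z + g z)\<^sup>2 = (f z - g z)\<^sup>2" by algebra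
    then have "(f z + g z)\<^sup>2 \<le> 2 * (f z)\<^sup>2 + 2 * (g z)\<^sup>2"
      using zero_le_power2[of "f z - g z"] by linarith
    then show "norm ((f z + g z)\<^sup>2) \<le> norm (2 * (f z)\<^sup>2 + 2 * (g z)\<^sup>2)" by simp
  qed
qed (use fg in auto)

text \<open>Against linear strategies the interim payoff is, up to a constant, minus the squared
  distance of the action from the conditional expectation of
  \<open>(1 - out_degree G i) \<theta> + (\<Sum>j\<noteq>i. G $ i $ j * a j)\<close>.\<close>

lemma interim_payoff_linear:
  fixes G :: "real^'n^'n::finite"
  assumes \<tau>: "0 < \<tau>x" "0 < \<tau>y" and s: "\<And>j u v. s j u v = \<alpha> j * u + \<beta> j * v + \<kappa> j"
  defines "m \<equiv> \<lambda>x y. (\<tau>x * x + \<tau>y * y) / (\<tau>x + \<tau>y)"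
  shows "\<exists>K. \<forall>b. interim_payoff G \<tau>x \<tau>y s i x y b =
    K - (b - ((1 - out_degree G i) * m x y + (\<Sum>j\<in>UNIV - {i}. G $ i $ j * s j (m x y) y)))\<^sup>2"
proof -
  let ?P = "posterior \<tau>x \<tau>y x y" and ?Q = "private_noise \<tau>x :: ('n \<Rightarrow> real) measure"
  let ?m = "m x y"
  have "0 < 1 / sqrt (\<tau>x + \<tau>y)" using \<tau> by simp
  moreover have "?P = density lborel (\<lambda>e. ennreal (normal_density ?m (1 / sqrt (\<tau>x + \<tau>y)) e))"
    unfolding m_def by (rule posterior_eq[OF \<tau>])
  ultimately have pm: "prob_space ?P" "integrable ?P (\<lambda>e. e)" "integral\<^sup>L ?P (\<lambda>e. e) = ?m"
    "integrable ?P (\<lambda>e. e\<^sup>2)"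
    using normal_measure_moments by simp_all
  have P: "prob_space ?P" and Q: "prob_space ?Q"
    using pm private_noise_prob_space[OF \<tau>(1)] by auto
  define M where "M = ?P \<Otimes>\<^sub>M ?Q"
  interpret P: prob_space ?P by (rule P)
  interpret Q: prob_space ?Q by (rule Q)
  interpret PQ: pair_prob_space ?P ?Q ..
  interpret M: prob_space M unfolding M_def by (rule PQ.prob_space_axioms)
  have th: "integrable M fst" "integral\<^sup>L M fst = ?m" "integrable M (\<lambda>z. (fst z)\<^sup>2)"
    using pair_prob_fst_snd(1,2)[OF P Q, of "\<lambda>e. e"] pair_prob_fst_snd(1)[OF P Q, of "\<lambda>e. e\<^sup>2"] pm
    by (simp_all add: M_def)
  have q: "integrable ?Q (\<lambda>\<epsilon>. \<epsilon> j)" "(\<integral>\<epsilon>. \<epsilon> j \<partial>?Q) = 0" "integrable ?Q (\<lambda>\<epsilon>. (\<epsilon> j)\<^sup>2)" for j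
    using private_noise_component[OF \<tau>(1), of "\<lambda>e. e" j] private_noise_component[OF \<tau>(1), of "\<lambda>e. e\<^sup>2" j]
    by (simp_all add: gaussian_noise_moments[OF \<tau>(1)])
  have ep: "integrable M (\<lambda>z. snd z j)" "(\<integral>z. snd z j \<partial>M) = 0" "integrable M (\<lambda>z. (snd z j)\<^sup>2)" for j
    using pair_prob_fst_snd(3,4)[OF P Q q(1)[of j]] pair_prob_fst_snd(3)[OF P Q q(3)[of j]] q(2)[of j]
    by (simp_all add: M_def)
  define Z where "Z j z = s j (fst z + snd z j) y" for j and z :: "real \<times> ('n \<Rightarrow> real)"
  have Z: "Z j z = \<alpha> j * (fst z + snd z j) + (\<beta> j * y + \<kappa> j)" for j z
    by (simp add: Z_def s)
  have Z1: "integrable M (Z j)" "integral\<^sup>L M (Z j) = s j ?m y" for j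
    unfolding Z[abs_def] by (simp_all add: th ep s M.prob_space)
  have sq: "integrable M (\<lambda>z. (fst z + snd z j)\<^sup>2)" for j
    by (rule integrable_square_sum) (simp_all add: th ep borel_measurable_integrable)
  have Z2: "integrable M (\<lambda>z. (Z j z)\<^sup>2)" for j
    unfolding Z
    by (rule integrable_square_sum)
       (simp_all add: th ep sq power_mult_distrib borel_measurable_integrable)
  have quad: "integrable M (\<lambda>z. (b - f z)\<^sup>2) \<and>
      (\<integral>z. (b - f z)\<^sup>2 \<partial>M) = b\<^sup>2 - 2 * b * integral\<^sup>L M f + (\<integral>z. (f z)\<^sup>2 \<partial>M)"
    if "integrable M f" "integrable M (\<lambda>z. (f z)\<^sup>2)" for b and f :: "real \<times> ('n \<Rightarrow> real) \<Rightarrow> real"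
  proof -
    have e: "(b - f z)\<^sup>2 = b\<^sup>2 - 2 * b * f z + (f z)\<^sup>2" for z by algebra
    show ?thesis unfolding e using that by (simp add: M.prob_space)
  qed
  let ?N = "UNIV - {i}" and ?d = "out_degree G i"
  define R where "R = (1 - ?d) * ?m + (\<Sum>j\<in>?N. G $ i $ j * s j ?m y)"
  define K where "K = R\<^sup>2 - (1 - ?d) * (\<integral>z. (fst z)\<^sup>2 \<partial>M) - (\<Sum>j\<in>?N. G $ i $ j * (\<integral>z. (Z j z)\<^sup>2 \<partial>M))"
  have "interim_payoff G \<tau>x \<tau>y s i x y b = K - (b - R)\<^sup>2" for b
  proof -
    have "interim_payoff G \<tau>x \<tau>y s i x y b =
      (\<integral>z. - (1 - ?d) * (b - fst z)\<^sup>2 - (\<Sum>j\<in>?N. G $ i $ j * (b - Z j z)\<^sup>2) \<partial>M)"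
      unfolding interim_payoff_def M_def[symmetric]
      by (rule Bochner_Integration.integral_cong)
         (auto simp: payoff_def out_degree_def Z_def split_beta intro!: sum.cong)
    also have "\<dots> = - (1 - ?d) * (b\<^sup>2 - 2 * b * ?m + (\<integral>z. (fst z)\<^sup>2 \<partial>M))
      - (\<Sum>j\<in>?N. G $ i $ j * (b\<^sup>2 - 2 * b * s j ?m y + (\<integral>z. (Z j z)\<^sup>2 \<partial>M)))"
      using quad[OF th(1,3), of b] quad[OF Z1(1) Z2, of b]
      by (subst Bochner_Integration.integral_diff)
         (auto simp: Bochner_Integration.integral_sum th Z1 intro!: Bochner_Integration.integrable_sum)
    also have "(\<Sum>j\<in>?N. G $ i $ j * (b\<^sup>2 - 2 * b * s j ?m y + (\<integral>z. (Z j z)\<^sup>2 \<partial>M))) =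
      ?d * b\<^sup>2 - 2 * b * (\<Sum>j\<in>?N. G $ i $ j * s j ?m y) + (\<Sum>j\<in>?N. G $ i $ j * (\<integral>z. (Z j z)\<^sup>2 \<partial>M))"
      by (simp add: out_degree_def sum_distrib_left sum_distrib_right sum.distrib sum_subtractf
          algebra_simps)
    finally show ?thesis
      by (simp add: K_def R_def power2_eq_square algebra_simps)
  qed
  then show ?thesis unfolding R_def by blast
qed

lemma linear_BNE_iff_best_response:
  fixes G :: "real^'n^'n::finite"
  assumes \<tau>: "0 < \<tau>x" "0 < \<tau>y"
  defines "m \<equiv> \<lambda>x y. (\<tau>x * x + \<tau>y * y) / (\<tau>x + \<tau>y)"
  shows "linear_BNE G \<tau>x \<tau>y s \<longleftrightarrow> (\<forall>i. linear_strategy (s i)) \<and>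
    (\<forall>i x y. s i x y =
      (1 - out_degree G i) * m x y + (\<Sum>j\<in>UNIV - {i}. G $ i $ j * s j (m x y) y))"
proof (cases "\<forall>i. linear_strategy (s i)")
  case True
  then obtain \<alpha> \<beta> \<kappa> where s: "\<And>j u v. s j u v = \<alpha> j * u + \<beta> j * v + \<kappa> j"
    unfolding linear_strategy_def by metis
  have "(\<forall>b. interim_payoff G \<tau>x \<tau>y s i x y b \<le> interim_payoff G \<tau>x \<tau>y s i x y c) \<longleftrightarrow>
    c = (1 - out_degree G i) * m x y + (\<Sum>j\<in>UNIV - {i}. G $ i $ j * s j (m x y) y)"
    (is "_ \<longleftrightarrow> c = ?R") for i x y c
  proof -
    obtain K where K: "\<And>b. interim_payoff G \<tau>x \<tau>y s i x y b = K - (b - ?R)\<^sup>2"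
      using interim_payoff_linear[OF \<tau>, of s \<alpha> \<beta> \<kappa>, OF s, where i = i and x = x and y = y and G = G]
      unfolding m_def by blast
    show ?thesis
    proof
      assume "\<forall>b. interim_payoff G \<tau>x \<tau>y s i x y b \<le> interim_payoff G \<tau>x \<tau>y s i x y c"
      then have "K - (?R - ?R)\<^sup>2 \<le> K - (c - ?R)\<^sup>2" unfolding K by blast
      then have "(c - ?R)\<^sup>2 \<le> 0" by simp
      then show "c = ?R" by simp
    next
      assume "c = ?R"
      then show "\<forall>b. interim_payoff G \<tau>x \<tau>y s i x y b \<le> interim_payoff G \<tau>x \<tau>y s i x y c"
        unfolding K by simp
    qed
  qed
  then show ?thesis using True unfolding linear_BNE_def by simp
next
  case False
  then show ?thesis unfolding linear_BNE_def by blast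
qed

theorem linear_BNE_iff:
  fixes G :: "real^'n^'n::finite"
  assumes G: "interaction_network G" and \<tau>: "0 < \<tau>x" "0 < \<tau>y"
  defines "\<gamma> \<equiv> \<tau>x / (\<tau>x + \<tau>y)"
  shows "linear_BNE G \<tau>x \<tau>y s \<longleftrightarrow>
    s = (\<lambda>i x y. (1 - \<gamma>) * katz_bonacich \<gamma> G $ i * y + (1 - (1 - \<gamma>) * katz_bonacich \<gamma> G $ i) * x)"
    (is "_ \<longleftrightarrow> s = ?s")
proof -
  have \<gamma>: "0 < \<gamma>" "\<gamma> < 1" using \<tau> by (simp_all add: \<gamma>_def)
  have "1 - \<gamma> = \<tau>y / (\<tau>x + \<tau>y)" using \<tau> by (simp add: \<gamma>_def field_simps)
  then have m: "(\<tau>x * x + \<tau>y * y) / (\<tau>x + \<tau>y) = \<gamma> * x + (1 - \<gamma>) * y" for x y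
    by (simp add: \<gamma>_def add_divide_distrib)
  note br = linear_BNE_iff_best_response[OF \<tau>, of G s, unfolded m]
  let ?N = "\<lambda>i. UNIV - {i}"
  let ?c = "katz_bonacich \<gamma> G"
  have c: "?c $ i = 1 + \<gamma> * (\<Sum>j\<in>?N i. G $ i $ j * ?c $ j)" for i
    using katz_bonacich_iff[OF G less_imp_le[OF \<gamma>(1)] less_imp_le[OF \<gamma>(2)], of ?c] by blast
  show ?thesis
  proof
    assume "linear_BNE G \<tau>x \<tau>y s"
    then have lin: "\<forall>i. linear_strategy (s i)" and
      eq: "\<And>i x y. s i x y = (1 - out_degree G i) * (\<gamma> * x + (1 - \<gamma>) * y)
        + (\<Sum>j\<in>?N i. G $ i $ j * s j (\<gamma> * x + (1 - \<gamma>) * y) y)"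
      unfolding br by blast+
    obtain \<alpha> \<beta> \<kappa> where s: "\<And>j u v. s j u v = \<alpha> j * u + \<beta> j * v + \<kappa> j"
      using lin unfolding linear_strategy_def by metis
    have "\<kappa> i = 1 * (\<Sum>j\<in>?N i. G $ i $ j * \<kappa> j)" for i
      using eq[of i 0 0] by (simp add: s)
    from network_fixed_point_zero[OF G _ _ this] have k: "\<kappa> i = 0" for i by simp
    have "\<alpha> i + \<beta> i - 1 = 1 * (\<Sum>j\<in>?N i. G $ i $ j * (\<alpha> j + \<beta> j - 1))" for i
      using eq[of i 1 1]
      by (simp add: s k out_degree_def algebra_simps sum.distrib sum_subtractf)
    from network_fixed_point_zero[OF G _ _ this] have ab: "\<beta> i = 1 - \<alpha> i" for i
      by (simp add: algebra_simps)
    have al: "\<alpha> i = \<gamma> * (1 - out_degree G i) + \<gamma> * (\<Sum>j\<in>?N i. G $ i $ j * \<alpha> j)" for i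
      using eq[of i 1 0] by (simp add: s k sum_distrib_left algebra_simps)
    have "1 - \<alpha> i - (1 - \<gamma>) * ?c $ i =
      \<gamma> * (\<Sum>j\<in>?N i. G $ i $ j * (1 - \<alpha> j - (1 - \<gamma>) * ?c $ j))" for i
    proof -
      have "(\<Sum>j\<in>?N i. G $ i $ j * (1 - \<alpha> j - (1 - \<gamma>) * ?c $ j)) =
        out_degree G i - (\<Sum>j\<in>?N i. G $ i $ j * \<alpha> j) - (1 - \<gamma>) * (\<Sum>j\<in>?N i. G $ i $ j * ?c $ j)"
        by (simp add: out_degree_def sum_distrib_left sum_subtractf sum.distrib algebra_simps)
      then show ?thesis
        using al[of i] c[of i] by algebra
    qed
    from network_fixed_point_zero[OF G _ _ this] \<gamma>
    have a: "\<alpha> i = 1 - (1 - \<gamma>) * ?c $ i" for i by (simp add: algebra_simps)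
    show "s = ?s" by (intro ext) (simp add: s k ab a)
  next
    assume s: "s = ?s"
    have "linear_strategy (s i)" for i
      unfolding linear_strategy_def s
      by (intro exI[of _ "1 - (1 - \<gamma>) * ?c $ i"] exI[of _ "(1 - \<gamma>) * ?c $ i"] exI[of _ 0]) simp
    moreover have "s i x y = (1 - out_degree G i) * (\<gamma> * x + (1 - \<gamma>) * y)
        + (\<Sum>j\<in>?N i. G $ i $ j * s j (\<gamma> * x + (1 - \<gamma>) * y) y)" for i x y
    proof -
      let ?m = "\<gamma> * x + (1 - \<gamma>) * y"
      have "s j ?m y = ?m + (1 - \<gamma>) * (y - ?m) * ?c $ j" for j
        unfolding s by (simp add: algebra_simps)
      then have "(\<Sum>j\<in>?N i. G $ i $ j * s j ?m y) =
        out_degree G i * ?m + (1 - \<gamma>) * (y - ?m) * (\<Sum>j\<in>?N i. G $ i $ j * ?c $ j)"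
        by (simp add: out_degree_def sum_distrib_left sum_distrib_right sum.distrib distrib_left ac_simps)
      moreover have "y - ?m = \<gamma> * (y - x)" by (simp add: algebra_simps)
      moreover have "s i x y = x + (1 - \<gamma>) * (y - x) * ?c $ i"
        unfolding s by (simp add: algebra_simps)
      ultimately show ?thesis
        using c[of i] by algebra
    qed
    ultimately show "linear_BNE G \<tau>x \<tau>y s" unfolding br by blast
  qed
qed

corollary equilibrium_eq:
  fixes G :: "real^'n^'n::finite"
  assumes "interaction_network G" "0 < \<tau>x" "0 < \<tau>y"
  defines "\<gamma> \<equiv> \<tau>x / (\<tau>x + \<tau>y)"
  shows "equilibrium G \<tau>x \<tau>y =
    (\<lambda>i x y. (1 - \<gamma>) * katz_bonacich \<gamma> G $ i * y + (1 - (1 - \<gamma>) * katz_bonacich \<gamma> G $ i) * x)"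
  unfolding equilibrium_def \<gamma>_def
  by (rule the_equality) (simp_all only: linear_BNE_iff[OF assms(1-3)])

lemma welfare_effect_state_independent:
  fixes G :: "real^'n^'n::finite"
  assumes "interaction_network G" "0 < \<tau>x" "0 < \<tau>y"
  shows "welfare_effect \<tau>x \<tau>y G \<theta> = welfare_effect \<tau>x \<tau>y G 0"
proof -
  have shift: "payoff G i (\<lambda>j. \<theta> + a j) \<theta> = payoff G i a 0" for i a
    by (simp add: payoff_def)
  have "k * (\<theta> + v) + (1 - k) * (\<theta> + u) = \<theta> + (k * v + (1 - k) * u)" for k u v :: real
    by algebra
  then have "equilibrium G \<tau>x \<tau>y j (\<theta> + u) (\<theta> + v) = \<theta> + equilibrium G \<tau>x \<tau>y j u v" for j u v
    unfolding equilibrium_eq[OF assms] .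
  then show ?thesis
    by (simp add: welfare_effect_def welfare_def welfare_no_public_def shift)
qed

end

theory Submission
  imports Defs
begin

text \<open>With \<open>p i = (1 - \<gamma>) * c i\<close> the equilibrium weight on the public signal, welfare is an explicit
  quadratic form in \<open>p\<close>.  Without links the public signal always helps.  It hurts when agents
  who put moderate weight on it are linked to a hub that puts a large weight on it: in \<open>G'\<close> two
  agents \<open>u\<close>, \<open>v\<close> are linked to each other almost to the maximum, so that \<open>c u = c v = 50\<close>, and
  every other agent has a link to \<open>u\<close> of weight about \<open>1/2\<close>, hence the smaller centrality \<open>26\<close>; the
  miscoordination losses \<open>g i u * (p i - p u)\<^sup>2\<close> and the exposure of these agents to the public noise
  then outweigh the gains.  All these numbers are exact for \<open>\<gamma> = 99/100\<close>.\<close>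

text \<open>The noise terms have mean zero and are uncorrelated, so only the three squares survive.
  Allowing \<open>i = j\<close> when \<open>c = 0\<close> lets one statement cover both the distance
  of an action from the state and the distance between two actions.\<close>

lemma joint_noise_second_moment:
  fixes i j :: "'n::finite"
  assumes \<tau>: "0 < \<tau>x" "0 < \<tau>y" and ij: "i \<noteq> j \<or> c = 0"
  shows "integrable (joint_noise \<tau>x \<tau>y) (\<lambda>z. (a * snd z + b * fst z i + c * fst z j)\<^sup>2)"
    and "(\<integral>z. (a * snd z + b * fst z i + c * fst z j)\<^sup>2 \<partial>joint_noise \<tau>x \<tau>y) =
      a\<^sup>2 / \<tau>y + (b\<^sup>2 + c\<^sup>2) / \<tau>x"
proof -
  let ?P = "private_noise \<tau>x :: ('n \<Rightarrow> real) measure" and ?Q = "gaussian_noise \<tau>y"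
  define M where "M = ?P \<Otimes>\<^sub>M ?Q"
  note g = gaussian_noise_moments
  have P: "prob_space ?P" and Q: "prob_space ?Q"
    using private_noise_prob_space[OF \<tau>(1)] g(1)[OF \<tau>(2)] by auto
  interpret P: prob_space ?P by (rule P)
  interpret Q: prob_space ?Q by (rule Q)
  interpret PQ: pair_prob_space ?P ?Q ..
  have p: "integrable ?P (\<lambda>\<epsilon>. \<epsilon> k)" "integrable ?P (\<lambda>\<epsilon>. (\<epsilon> k)\<^sup>2)"
    "(\<integral>\<epsilon>. \<epsilon> k \<partial>?P) = 0" "(\<integral>\<epsilon>. (\<epsilon> k)\<^sup>2 \<partial>?P) = 1 / \<tau>x" for k
    using private_noise_component[OF \<tau>(1), of "\<lambda>e. e" k] private_noise_component[OF \<tau>(1), of "\<lambda>e. e\<^sup>2" k]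
    by (simp_all add: g[OF \<tau>(1)])
  have x: "integrable M (\<lambda>z. fst z k)" "integrable M (\<lambda>z. (fst z k)\<^sup>2)"
    "(\<integral>z. (fst z k)\<^sup>2 \<partial>M) = 1 / \<tau>x" for k
    using pair_prob_fst_snd(1,2)[OF P Q, of "\<lambda>\<epsilon>. \<epsilon> k"] pair_prob_fst_snd(1,2)[OF P Q, of "\<lambda>\<epsilon>. (\<epsilon> k)\<^sup>2"] p
    by (simp_all add: M_def)
  have y: "integrable M snd" "integrable M (\<lambda>z. (snd z)\<^sup>2)" "(\<integral>z. (snd z)\<^sup>2 \<partial>M) = 1 / \<tau>y"
    using pair_prob_fst_snd(3,4)[OF P Q, of "\<lambda>e. e"] pair_prob_fst_snd(3,4)[OF P Q, of "\<lambda>e. e\<^sup>2"]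
    by (simp_all add: M_def g[OF \<tau>(2)])
  \<comment> \<open>Polarization: the product is half of the square of the sum minus the two
    squares, all of which are integrable.\<close>
  have xy: "integrable M (\<lambda>z. snd z * fst z k)" for k
  proof -
    have "integrable M (\<lambda>z. (snd z + fst z k)\<^sup>2)"
      by (rule integrable_square_sum) (simp_all add: x y borel_measurable_integrable)
    then have "integrable M (\<lambda>z. ((snd z + fst z k)\<^sup>2 - (snd z)\<^sup>2 - (fst z k)\<^sup>2) / 2)"
      using x y by simp
    moreover have "((v + u)\<^sup>2 - v\<^sup>2 - u\<^sup>2) / 2 = v * u" for u v :: real
      by (simp add: power2_sum)
    ultimately show ?thesis by simp
  qed
  \<comment> \<open>By Fubini the public noise can be integrated first, and its mean is
    zero.\<close>
  have xy0: "(\<integral>z. snd z * fst z k \<partial>M) = 0" for k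
    using PQ.integral_fst'[OF xy[of k, unfolded M_def]] by (simp add: M_def g[OF \<tau>(2)])
  \<comment> \<open>The coefficient \<open>c\<close> is kept inside \<open>X\<close>: for
    \<open>i = j\<close> the bare product has mean \<open>1 / \<tau>x\<close>, and only the factor
    \<open>c = 0\<close> makes it vanish.\<close>
  define X where "X z = c * (fst z i * fst z j)" for z :: "('n \<Rightarrow> real) \<times> real"
  have xx: "integrable M X" "integral\<^sup>L M X = 0"
    using ij private_noise_uncorrelated[OF \<tau>(1), of i j]
      pair_prob_fst_snd(1,2)[OF P Q, of "\<lambda>\<epsilon>. \<epsilon> i * \<epsilon> j"]
    by (auto simp: M_def X_def[abs_def])
  have e: "(a * snd z + b * fst z i + c * fst z j)\<^sup>2 =
    a\<^sup>2 * (snd z)\<^sup>2 + b\<^sup>2 * (fst z i)\<^sup>2 + c\<^sup>2 * (fst z j)\<^sup>2 + (2 * a * b) * (snd z * fst z i)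
    + (2 * a * c) * (snd z * fst z j) + 2 * b * X z" for z
    unfolding X_def by algebra
  show "integrable (joint_noise \<tau>x \<tau>y) (\<lambda>z. (a * snd z + b * fst z i + c * fst z j)\<^sup>2)"
    unfolding joint_noise_def M_def[symmetric] e
    by (intro Bochner_Integration.integrable_add integrable_mult_right x y xy xx)
  show "(\<integral>z. (a * snd z + b * fst z i + c * fst z j)\<^sup>2 \<partial>joint_noise \<tau>x \<tau>y) =
      a\<^sup>2 / \<tau>y + (b\<^sup>2 + c\<^sup>2) / \<tau>x"
    unfolding joint_noise_def M_def[symmetric] e
    by (simp add: x y xy xy0 xx add_divide_distrib)
qed

text \<open>After scaling by \<open>\<tau>x\<close> the precisions enter only through
  \<open>\<tau>x / \<tau>y\<close>, hence through \<open>\<gamma>\<close>. The sign of the welfare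
  effect is therefore the same for all precisions with a given \<open>\<gamma>\<close>.\<close>

lemma welfare_effect_eq:
  fixes G :: "real^'n^'n::finite"
  assumes G: "interaction_network G" and \<tau>: "0 < \<tau>x" "0 < \<tau>y"
  defines "\<gamma> \<equiv> \<tau>x / (\<tau>x + \<tau>y)"
  defines "p \<equiv> \<lambda>i. (1 - \<gamma>) * katz_bonacich \<gamma> G $ i"
  shows "\<tau>x * welfare_effect \<tau>x \<tau>y G \<theta> =
    (\<Sum>i\<in>UNIV. 2 * p i - (p i)\<^sup>2 - (1 - out_degree G i) * (\<tau>x / \<tau>y * (p i)\<^sup>2)
      + (\<Sum>j\<in>UNIV - {i}. G $ i $ j * (2 * p j - (p j)\<^sup>2 - \<tau>x / \<tau>y * (p i - p j)\<^sup>2)))"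
proof -
  let ?M = "joint_noise \<tau>x \<tau>y :: (('n \<Rightarrow> real) \<times> real) measure"
  let ?q = "\<lambda>i. 1 - p i" and ?d = "out_degree G"
  have own: "integrable ?M (\<lambda>z. (p i * snd z + ?q i * fst z i)\<^sup>2)"
    "(\<integral>z. (p i * snd z + ?q i * fst z i)\<^sup>2 \<partial>?M) = (p i)\<^sup>2 / \<tau>y + (?q i)\<^sup>2 / \<tau>x" for i
    using joint_noise_second_moment[OF \<tau>, of i i 0 "p i" "?q i"] by simp_all
  have cross: "integrable ?M (\<lambda>z. ((p i - p j) * snd z + ?q i * fst z i + (- ?q j) * fst z j)\<^sup>2)"
    "(\<integral>z. ((p i - p j) * snd z + ?q i * fst z i + (- ?q j) * fst z j)\<^sup>2 \<partial>?M) =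
      (p i - p j)\<^sup>2 / \<tau>y + ((?q i)\<^sup>2 + (?q j)\<^sup>2) / \<tau>x" if "i \<noteq> j" for i j
    using joint_noise_second_moment[OF \<tau>, of i j "- ?q j" "p i - p j" "?q i"] that
    by (simp_all add: power2_commute[of "p j" 1])
  have W: "(\<integral>(\<epsilon>, \<eta>). payoff G i (\<lambda>j. equilibrium G \<tau>x \<tau>y j (\<theta> + \<epsilon> j) (\<theta> + \<eta>)) \<theta> \<partial>?M) =
    - (1 - ?d i) * ((p i)\<^sup>2 / \<tau>y + (?q i)\<^sup>2 / \<tau>x)
    - (\<Sum>j\<in>UNIV - {i}. G $ i $ j * ((p i - p j)\<^sup>2 / \<tau>y + ((?q i)\<^sup>2 + (?q j)\<^sup>2) / \<tau>x))" for i
  proof -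
    \<comment> \<open>The weights on the two signals sum to one, so an action is the state plus
      weighted noise and the state cancels in every payoff term.\<close>
    have "k * (\<theta> + v) + (1 - k) * (\<theta> + u) = \<theta> + (k * v + (1 - k) * u)" for k u v :: real
      by algebra
    then have eq: "equilibrium G \<tau>x \<tau>y j (\<theta> + u) (\<theta> + v) = \<theta> + (p j * v + ?q j * u)" for j u v
      unfolding equilibrium_eq[OF G \<tau>] p_def \<gamma>_def .
    have "(\<integral>(\<epsilon>, \<eta>). payoff G i (\<lambda>j. equilibrium G \<tau>x \<tau>y j (\<theta> + \<epsilon> j) (\<theta> + \<eta>)) \<theta> \<partial>?M) =
      (\<integral>z. - (1 - ?d i) * (p i * snd z + ?q i * fst z i)\<^sup>2 - (\<Sum>j\<in>UNIV - {i}.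
        G $ i $ j * ((p i - p j) * snd z + ?q i * fst z i + (- ?q j) * fst z j)\<^sup>2) \<partial>?M)"
      unfolding payoff_def eq out_degree_def
      by (rule Bochner_Integration.integral_cong)
         (auto simp: split_beta algebra_simps intro!: sum.cong arg_cong[where f = "\<lambda>t. t\<^sup>2"])
    also have "\<dots> = - (1 - ?d i) * ((p i)\<^sup>2 / \<tau>y + (?q i)\<^sup>2 / \<tau>x)
      - (\<Sum>j\<in>UNIV - {i}. G $ i $ j * ((p i - p j)\<^sup>2 / \<tau>y + ((?q i)\<^sup>2 + (?q j)\<^sup>2) / \<tau>x))"
      using own[of i] cross[of i]
      by (subst Bochner_Integration.integral_diff)
         (auto simp: Bochner_Integration.integral_sum simp del: mult_minus_left
           intro!: Bochner_Integration.integrable_sum)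
    finally show ?thesis .
  qed
  \<comment> \<open>The summand \<open>1 + ?d i\<close> cancels the loss without public signal.
    Since \<open>(?q j)\<^sup>2 = 1 - (2 * p j - (p j)\<^sup>2)\<close>, the terms in
    \<open>(?q i)\<^sup>2\<close> add up to total weight one, which leaves
    \<open>2 * p i - (p i)\<^sup>2\<close>.\<close>
  have T: "\<tau>x * (- (1 - ?d i) * ((p i)\<^sup>2 / \<tau>y + (?q i)\<^sup>2 / \<tau>x)
      - (\<Sum>j\<in>UNIV - {i}. G $ i $ j * ((p i - p j)\<^sup>2 / \<tau>y + ((?q i)\<^sup>2 + (?q j)\<^sup>2) / \<tau>x)))
      + (1 + ?d i) =
    2 * p i - (p i)\<^sup>2 - (1 - ?d i) * (\<tau>x / \<tau>y * (p i)\<^sup>2)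
      + (\<Sum>j\<in>UNIV - {i}. G $ i $ j * (2 * p j - (p j)\<^sup>2 - \<tau>x / \<tau>y * (p i - p j)\<^sup>2))" for i
  proof -
    have m: "\<tau>x * (u / \<tau>y + v / \<tau>x) = \<tau>x / \<tau>y * u + v" for u v
      using \<tau> by (simp add: field_simps)
    have "\<tau>x * (\<Sum>j\<in>UNIV - {i}. G $ i $ j * ((p i - p j)\<^sup>2 / \<tau>y + ((?q i)\<^sup>2 + (?q j)\<^sup>2) / \<tau>x)) =
      (\<Sum>j\<in>UNIV - {i}. G $ i $ j * (\<tau>x / \<tau>y * (p i - p j)\<^sup>2 + ((?q i)\<^sup>2 + (?q j)\<^sup>2)))"
      unfolding sum_distrib_left m[symmetric] by (simp only: mult.left_commute)
    also have "\<dots> = (\<Sum>j\<in>UNIV - {i}. G $ i $ j * ((?q i)\<^sup>2 + 1)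
        - G $ i $ j * (2 * p j - (p j)\<^sup>2 - \<tau>x / \<tau>y * (p i - p j)\<^sup>2))"
      by (rule sum.cong[OF refl]) algebra
    also have "\<dots> = ?d i * ((?q i)\<^sup>2 + 1)
      - (\<Sum>j\<in>UNIV - {i}. G $ i $ j * (2 * p j - (p j)\<^sup>2 - \<tau>x / \<tau>y * (p i - p j)\<^sup>2))"
      by (simp only: sum_subtractf out_degree_def sum_distrib_right)
    finally show ?thesis
      using m[of "(p i)\<^sup>2" "(?q i)\<^sup>2"] by algebra
  qed
  have "\<tau>x * welfare_no_public \<tau>x G \<theta> = - (\<Sum>i\<in>UNIV. 1 + ?d i)"
    unfolding welfare_no_public_eq[OF \<tau>(1)] sum_distrib_left[symmetric] using \<tau> by simp
  then have "\<tau>x * welfare_effect \<tau>x \<tau>y G \<theta> = (\<Sum>i\<in>UNIV.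
    \<tau>x * (- (1 - ?d i) * ((p i)\<^sup>2 / \<tau>y + (?q i)\<^sup>2 / \<tau>x)
      - (\<Sum>j\<in>UNIV - {i}. G $ i $ j * ((p i - p j)\<^sup>2 / \<tau>y + ((?q i)\<^sup>2 + (?q j)\<^sup>2) / \<tau>x)))
      + (1 + ?d i))"
    unfolding welfare_effect_def welfare_def W by (simp only: right_diff_distrib sum.distrib sum_distrib_left)
  then show ?thesis unfolding T .
qed

text \<open>All centralities are 1, so every \<open>p i\<close> is \<open>1 - \<gamma>\<close>, and
  with \<open>\<tau>x / \<tau>y = \<gamma> / (1 - \<gamma>)\<close> each agent contributes exactly
  \<open>1 - \<gamma>\<close> to the scaled effect.\<close>

lemma welfare_effect_zero_pos:
  assumes \<tau>: "0 < \<tau>x" "0 < \<tau>y"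
  shows "0 < welfare_effect \<tau>x \<tau>y (0 :: real^'n^'n::finite) \<theta>"
proof -
  define \<gamma> where "\<gamma> = \<tau>x / (\<tau>x + \<tau>y)"
  have \<gamma>: "0 < \<gamma>" "\<gamma> < 1" using \<tau> by (simp_all add: \<gamma>_def)
  have N: "interaction_network (0 :: real^'n^'n)" and d: "out_degree (0 :: real^'n^'n) i = 0" for i
    by (simp_all add: interaction_network_def out_degree_def)
  have k: "katz_bonacich \<gamma> (0 :: real^'n^'n) = 1"
    using katz_bonacich_iff[OF N, of \<gamma> 1] \<gamma> by simp
  have "\<tau>x / \<tau>y * (1 - \<gamma>) = \<gamma>" using \<tau> by (simp add: \<gamma>_def field_simps)
  then have "2 * (1 - \<gamma>) - (1 - \<gamma>)\<^sup>2 - \<tau>x / \<tau>y * (1 - \<gamma>)\<^sup>2 = 1 - \<gamma>"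
    by (simp add: power2_eq_square mult.assoc[symmetric] del: times_divide_eq_left)
       (simp add: algebra_simps)
  then have "\<tau>x * welfare_effect \<tau>x \<tau>y (0 :: real^'n^'n) \<theta> = real CARD('n) * (1 - \<gamma>)"
    unfolding welfare_effect_eq[OF N \<tau>, folded \<gamma>_def] k d by simp
  then show ?thesis using \<tau> \<gamma>
    by (metis mult_pos_pos zero_less_mult_pos of_nat_0_less_iff zero_less_card_finite diff_gt_0_iff_gt)
qed

text \<open>With at most one outgoing link per agent, every sum over neighbours collapses to a
  single term, so the centrality equations can be solved by hand.\<close>

definition functional_network :: "('n \<Rightarrow> 'n) \<Rightarrow> ('n \<Rightarrow> real) \<Rightarrow> real^'n^'n::finite" where
  "functional_network t w = (\<chi> i j. if j = t i then w i else 0)"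

lemma functional_network_sum:
  assumes "t i \<noteq> i"
  shows "(\<Sum>j\<in>UNIV - {i}. functional_network t w $ i $ j * f j) = w i * f (t i)"
  using assms by (simp add: functional_network_def if_distrib[of "\<lambda>x. x * _"] sum.delta cong: if_cong)

lemma functional_network_out_degree:
  assumes "t i \<noteq> i"
  shows "out_degree (functional_network t w) i = w i"
  using functional_network_sum[of t i w "\<lambda>_. 1"] assms by (simp add: out_degree_def)

lemma functional_network_interaction_network:
  assumes "\<And>i. t i \<noteq> i" "\<And>i. 0 \<le> w i" "\<And>i. w i < 1"
  shows "interaction_network (functional_network t w)"
proof -
  have "0 \<le> functional_network t w $ i $ j" "functional_network t w $ i $ i = 0" for i j
    using assms(1)[of i] assms(2)[of i] by (auto simp: functional_network_def)
  then show ?thesis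
    using assms by (simp add: interaction_network_def functional_network_out_degree)
qed

theorem corollary1:
  assumes "CARD('n::finite) \<ge> 3"
  shows "\<exists>\<gamma>::real. 0 < \<gamma> \<and> \<gamma> < 1 \<and>
    (\<exists>G G' :: real^'n^'n.
       interaction_network G \<and> interaction_network G' \<and>
       (\<forall>i j. G $ i $ j \<le> G' $ i $ j) \<and>
       (\<forall>\<tau>x \<tau>y. 0 < \<tau>x \<longrightarrow> 0 < \<tau>y \<longrightarrow> \<tau>x / (\<tau>x + \<tau>y) = \<gamma> \<longrightarrow>
          (\<forall>\<theta>. welfare_effect \<tau>x \<tau>y G' \<theta> < 0 \<and> 0 < welfare_effect \<tau>x \<tau>y G \<theta>)))"
proof -
  obtain u v :: 'n where uv: "u \<noteq> v"
    using assms card_2_iff'[of "UNIV :: 'n set"] card_le_Suc0_iff_eq[of "UNIV :: 'n set"]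
    by auto
  define t where "t i = (if i = u then v else u)" for i
  \<comment> \<open>The denominator 99 cancels against \<open>\<gamma> = 99 / 100\<close>: the
    products of \<open>\<gamma>\<close> with the weights are 49/50 and 1/2, and
    \<open>50 = 1 + 49/50 * 50\<close>, \<open>26 = 1 + 1/2 * 50\<close>.\<close>
  define w :: "'n \<Rightarrow> real" where "w i = (if i \<in> {u, v} then 98 / 99 else 50 / 99)" for i
  define c :: "real^'n" where "c = (\<chi> i. if i \<in> {u, v} then 50 else 26)"
  let ?G = "functional_network t w"
  have t: "t i \<noteq> i" for i using uv by (simp add: t_def)
  have G: "interaction_network ?G"
    by (rule functional_network_interaction_network) (auto simp: t w_def)
  have "c $ i = 1 + 99 / 100 * (\<Sum>j\<in>UNIV - {i}. ?G $ i $ j * c $ j)" for i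
    unfolding functional_network_sum[of t, OF t] by (auto simp: c_def w_def t_def)
  then have k: "katz_bonacich (99 / 100) ?G = c"
    using katz_bonacich_iff[OF G, THEN iffD2, of "99 / 100" c] by fastforce
  have neg: "welfare_effect \<tau>x \<tau>y ?G \<theta> < 0"
    if \<tau>: "0 < \<tau>x" "0 < \<tau>y" and \<gamma>: "\<tau>x / (\<tau>x + \<tau>y) = 99 / 100" for \<tau>x \<tau>y \<theta>
  proof -
    have "\<tau>x = 99 * \<tau>y" using \<tau> \<gamma> by (simp add: field_simps)
    then have r: "\<tau>x / \<tau>y = 99" using \<tau> by simp
    \<comment> \<open>Here \<open>1 - \<gamma> = 1 / 100\<close>, so the weight on the public signal
      is \<open>c $ i / 100\<close>, that is 1/2 at \<open>u\<close> and \<open>v\<close> and 13/50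
      elsewhere.\<close>
    define T where "T i = 2 * (c $ i / 100) - (c $ i / 100)\<^sup>2 - (1 - w i) * (99 * (c $ i / 100)\<^sup>2)
      + w i * (2 * (c $ t i / 100) - (c $ t i / 100)\<^sup>2 - 99 * (c $ i / 100 - c $ t i / 100)\<^sup>2)" for i
    have T: "T i = (if i \<in> {u, v} then 123 / 99 else T i)"
      "i \<notin> {u, v} \<Longrightarrow> T i < - 5" for i
      by (auto simp: T_def c_def w_def t_def power2_eq_square)
    have "\<tau>x * welfare_effect \<tau>x \<tau>y ?G \<theta> = sum T UNIV"
      unfolding welfare_effect_eq[OF G \<tau>] \<gamma> k r functional_network_sum[of t, OF t]
        functional_network_out_degree[of t, OF t] T_def by simp
    also have "\<dots> = sum T {u, v} + sum T (UNIV - {u, v})"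
      by (subst sum.subset_diff[of "{u, v}"]) (auto simp: add.commute)
    also have "sum T {u, v} = 2 * (123 / 99)"
      using uv T(1)[of u] T(1)[of v] by simp
    also have "sum T (UNIV - {u, v}) \<le> (\<Sum>i\<in>UNIV - {u, v}. - 5)"
      using T(2) by (intro sum_mono less_imp_le) auto
    also have "\<dots> = - 5 * real (card (UNIV - {u, v}))" by simp
    \<comment> \<open>A third agent exists because \<open>n \<ge> 3\<close>; its loss of more than 5
      exceeds the joint gain 246/99 of \<open>u\<close> and \<open>v\<close>, and further agents
      only add to the loss.\<close>
    also have "\<dots> \<le> - 5"
      using assms uv by (simp add: card_Diff_subset)
    finally have "\<tau>x * welfare_effect \<tau>x \<tau>y ?G \<theta> < 0" by simp
    then show ?thesis using \<tau> by (simp add: mult_less_0_iff)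
  qed
  show ?thesis
  proof (rule exI[of _ "99 / 100"], intro conjI, goal_cases)
    case 3
    show ?case
    \<comment> \<open>The smaller network is the empty one, which lies below every network.\<close>
    proof (rule exI[of _ 0], rule exI[of _ ?G], intro conjI allI impI)
      show "interaction_network (0 :: real^'n^'n)"
        by (simp add: interaction_network_def out_degree_def)
      show "(0 :: real^'n^'n) $ i $ j \<le> ?G $ i $ j" for i j
        using G by (simp add: interaction_network_def)
    qed (simp_all add: G neg welfare_effect_zero_pos)
  qed simp_all
qed

end
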